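(* Let $f\ge1$ be an integer. The generating function $h(a,q;x)$ of generalized Schröder paths with backwards under the line $y=\frac xf$ (defined in the context) satisfies, and is determined by, the $q$-difference equation $$h(a,q;x)=h(a,q;q^2x)+q^fx\cdot h(a,q;q^{2(f+1)}x)+a^2q^{f-1}x\cdot h(a,q;q^{2f}x)$$ with the initial value $h(a,q;0)=1$.
   Context: $\mathbb{N}=\{0,1,2,\dots\}$. For $i,j,l\in\mathbb{N}$, $u_{i,j,l}$ is the number of lattice paths from $(0,0)$ to $(fl,l)$ with left steps $(-1,0)$, right steps $(1,0)$, up steps $(0,1)$ and exactly $\frac i2$ diagonal steps $(1,1)$ such that: each row ends with some (at least one) left steps, or ends at $(fl,l)$; a left step is never followed by a right step, and a right step is never followed by a left step; the path never goes above the line $y=\frac xf$; and the area enclosed by the path and the line $y=\frac xf$ is $\frac j2$. Explicitly, the row condition means: for $l\ge1$, horizontal steps at height $0$ are right steps; at each height $r$ with $1\le r\le l-1$ the path makes at least one left step and no right step; at height $l$ it makes zero or more left steps and no right step, ending at $(fl,l)$. For $l=0$ only the empty path is counted. Set $h(a,q;x):=\sum_{i,j,l\in\mathbb{N}}u_{i,j,l}\,a^iq^jx^l$, regarded as a formal power series in $x$ with coefficients in $\mathbb{Z}[a][[q]]$; "determined" means uniquely determined among such series. *)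

theory Defs
  imports "HOL-Analysis.Analysis" "HOL-Computational_Algebra.Computational_Algebra"
begin

datatype step = L | R | U | D

fun step_vec :: "step \<Rightarrow> int \<times> int" where
  "step_vec L = (-1, 0)"
| "step_vec R = (1, 0)"
| "step_vec U = (0, 1)"
| "step_vec D = (1, 1)"

text \<open>A lattice path starting at the origin is the list of its steps; \<open>vertex p n\<close> is the point
  reached after the first \<open>n\<close> steps.\<close>

definition vertex :: "step list \<Rightarrow> nat \<Rightarrow> int \<times> int" where
  "vertex p n = sum_list (map step_vec (take n p))"

definition real_pt :: "int \<times> int \<Rightarrow> real \<times> real" where
  "real_pt v = (real_of_int (fst v), real_of_int (snd v))"

definition path_trace :: "step list \<Rightarrow> (real \<times> real) set" where
  "path_trace p = insert (real_pt (vertex p 0))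
     (\<Union>n<length p. closed_segment (real_pt (vertex p n)) (real_pt (vertex p (Suc n))))"

definition slope_line :: "nat \<Rightarrow> (real \<times> real) set" where
  "slope_line f = {(x, y). y = x / real f}"

text \<open>The enclosed region consists of the bounded connected components of the complement of the
  path together with the line.\<close>

definition enclosed_area :: "nat \<Rightarrow> step list \<Rightarrow> real" where
  "enclosed_area f p = measure lborel (inside (path_trace p \<union> slope_line f))"

definition has_step_at :: "step list \<Rightarrow> step \<Rightarrow> nat \<Rightarrow> bool" where
  "has_step_at p s r \<longleftrightarrow> (\<exists>n<length p. p ! n = s \<and> snd (vertex p n) = int r)"

text \<open>Rows \<open>1, \<dots>, l - 1\<close> must contain a left step, the final row \<open>l\<close> need not; right steps
  occur only in row \<open>0\<close>.\<close>

definition row_condition :: "nat \<Rightarrow> step list \<Rightarrow> bool" where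
  "row_condition l p \<longleftrightarrow>
     (if l = 0 then p = []
      else \<not> has_step_at p L 0 \<and>
           (\<forall>r\<in>{1..<l}. has_step_at p L r \<and> \<not> has_step_at p R r) \<and>
           \<not> has_step_at p R l)"

definition no_backtrack :: "step list \<Rightarrow> bool" where
  "no_backtrack p \<longleftrightarrow>
     (\<forall>n. Suc n < length p \<longrightarrow>
        \<not> (p ! n = L \<and> p ! Suc n = R) \<and> \<not> (p ! n = R \<and> p ! Suc n = L))"

definition schroeder_backwards :: "nat \<Rightarrow> nat \<Rightarrow> nat \<Rightarrow> nat \<Rightarrow> step list set" where
  "schroeder_backwards f i j l =
     {p. vertex p (length p) = (int f * int l, int l) \<and>
         real (count_list p D) = real i / 2 \<and>
         row_condition l p \<and>
         no_backtrack p \<and>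
         (\<forall>(x, y)\<in>path_trace p. y \<le> x / real f) \<and>
         enclosed_area f p = real j / 2}"

definition u_count :: "nat \<Rightarrow> nat \<Rightarrow> nat \<Rightarrow> nat \<Rightarrow> nat" where
  "u_count f i j l = card (schroeder_backwards f i j l)"

text \<open>\<open>\<int>[a][[q]][[x]]\<close>: the outer series is in \<open>x\<close>, the inner one in \<open>q\<close>, the polynomials are
  in \<open>a\<close>.\<close>

type_synonym qxseries = "int poly fps fps"

definition va :: qxseries where "va = fps_const (fps_const [:0, 1:])"
definition vq :: qxseries where "vq = fps_const fps_X"
definition vx :: qxseries where "vx = fps_X"

text \<open>\<open>Abs_poly\<close> is only meaningful for finitely supported coefficient functions; the lemma
  \<open>coeff_schroeder_gf\<close> below shows that this is the case here.\<close>

definition schroeder_gf :: "nat \<Rightarrow> qxseries" where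
  "schroeder_gf f = Abs_fps (\<lambda>l. Abs_fps (\<lambda>j. Abs_poly (\<lambda>i. int (u_count f i j l))))"

text \<open>\<open>q_dilate k F\<close> is \<open>F(a, q; q\<^sup>k x)\<close>.\<close>

definition q_dilate :: "nat \<Rightarrow> qxseries \<Rightarrow> qxseries" where
  "q_dilate k F = fps_compose F (vq ^ k * vx)"

lemma count_D_le_height: "int (count_list p D) \<le> snd (sum_list (map step_vec p))"
proof (induction p)
  case (Cons s p)
  then show ?case by (cases s) auto
qed simp

lemma u_count_eq_0:
  assumes "i > 2 * l"
  shows "u_count f i j l = 0"
proof -
  have "p \<notin> schroeder_backwards f i j l" for p
  proof
    assume p: "p \<in> schroeder_backwards f i j l"
    have "int (count_list p D) \<le> int l"
      using count_D_le_height[of p] p by (simp add: schroeder_backwards_def vertex_def)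
    moreover have "real (count_list p D) = real i / 2"
      using p by (simp add: schroeder_backwards_def)
    ultimately show False using assms by linarith
  qed
  then have "schroeder_backwards f i j l = {}" by blast
  then show ?thesis by (simp add: u_count_def)
qed

lemma coeff_schroeder_gf:
  "coeff (fps_nth (fps_nth (schroeder_gf f) l) j) i = int (u_count f i j l)"
proof -
  have "\<forall>n>2 * l. int (u_count f n j l) = 0" using u_count_eq_0 by simp
  then have "\<forall>\<^sub>\<infinity>n. int (u_count f n j l) = 0" unfolding MOST_nat by blast
  then have "coeff (Abs_poly (\<lambda>i. int (u_count f i j l))) = (\<lambda>i. int (u_count f i j l))"
    by (intro Abs_poly_inverse) simp
  then show ?thesis by (simp add: schroeder_gf_def)
qed

end

theory Submission
  imports Defs
begin

text \<open>
  The right steps of such a path all lie in row 0, so apart from their number the path is a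
  sequence of \<open>l\<close> rows, row \<open>i\<close> being a rise (up or diagonal) followed by \<open>k\<^sub>i\<close> left steps. The
  endpoint \<open>(f l, l)\<close> fixes the number of right steps, and it makes the condition on the line
  automatic: each row advances by at most \<open>1 \<le> f\<close> to the right, so seen backwards from the endpoint
  the path never gets left of the line. Since all rows but the last need a left step, subtracting 1
  from their lengths leaves an arbitrary list over \<open>bool \<times> nat\<close>, a slack word, and
  paths correspond bijectively to slack words
  (\<open>schroeder_backwards_eq_image\<close>, \<open>row_path_inject\<close>).

  The path and the line bound one trapezoid per unit strip, of doubled area equal to the sum of
  its two horizontal widths (\<open>area_staircase\<close>). Expressed by rows, with
  \<open>d\<^sub>i \<in> {0, 1}\<close> recording a diagonal rise and \<open>i\<close> starting at 0, the
  doubled area is the sum of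
  \<open>2 (i + 1) k\<^sub>i + (2 i + 1) (f - d\<^sub>i)\<close> (\<open>enclosed_area_row_path\<close>): lengthening row \<open>i\<close> by one left
  step shifts the whole path below it to the right, widening \<open>i + 1\<close> strips.

  The three terms of the functional equation come from the last letter of a slack word
  (\<open>card_slack_words_Suc\<close>). If it has positive slack, one left step can be removed, which
  lowers the doubled area by \<open>2 l\<close> and gives \<open>h(q\<^sup>2 x)\<close>; if it has slack 0, deleting it
  gives the second or third term, depending on whether the last rise is up or diagonal. Uniqueness
  holds because the coefficient of \<open>x\<^sup>l\<close> appears with the factor \<open>1 - q\<^sup>2\<^sup>l\<close>, which is not a zero
  divisor for \<open>l > 0\<close>.
\<close>

section \<open>The shape of the paths\<close>

lemma vertex_full: "vertex p (length p) = sum_list (map step_vec p)"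
  by (simp add: vertex_def)

lemma vertex_append: "n \<le> length p \<Longrightarrow> vertex (p @ q) n = vertex p n"
  by (simp add: vertex_def)

lemma has_step_at_snoc:
  "has_step_at (p @ [t]) s r \<longleftrightarrow>
     has_step_at p s r \<or> (t = s \<and> snd (vertex p (length p)) = int r)"
proof -
  have "(\<exists>n<length p. (p @ [t]) ! n = s \<and> snd (vertex (p @ [t]) n) = int r) \<longleftrightarrow>
      (\<exists>n<length p. p ! n = s \<and> snd (vertex p n) = int r)"
    by (intro ex_cong1 conj_cong refl) (simp_all add: nth_append vertex_append)
  moreover have "vertex (p @ [t]) (length p) = vertex p (length p)"
    by (simp add: vertex_append)
  ultimately show ?thesis
    unfolding has_step_at_def length_append_singleton Ex_less_Suc by simp blast
qed

lemma height_horizontal: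
  assumes "set g \<subseteq> {L, R}"
  shows "snd (sum_list (map step_vec g)) = 0"
  using assms by (induction g) auto

lemma has_step_at_append_horizontal:
  assumes "set g \<subseteq> {L, R}"
  shows "has_step_at (p @ g) s r \<longleftrightarrow>
     has_step_at p s r \<or> (s \<in> set g \<and> snd (vertex p (length p)) = int r)"
  using assms
proof (induction g rule: rev_induct)
  case (snoc t g)
  have "set g \<subseteq> {L, R}" using snoc.prems by auto
  then have "snd (vertex (p @ g) (length (p @ g))) = snd (vertex p (length p))"
    using height_horizontal[of g] unfolding vertex_full by simp
  then have "has_step_at (p @ g @ [t]) s r \<longleftrightarrow>
      has_step_at (p @ g) s r \<or> (t = s \<and> snd (vertex p (length p)) = int r)"
    using has_step_at_snoc[of "p @ g" t s r] by (simp only: append_assoc)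
  also have "has_step_at (p @ g) s r \<longleftrightarrow>
      has_step_at p s r \<or> (s \<in> set g \<and> snd (vertex p (length p)) = int r)"
    using snoc.IH \<open>set g \<subseteq> {L, R}\<close> by blast
  finally show ?case by auto
qed simp

definition rise :: "bool \<Rightarrow> step" where
  "rise d = (if d then D else U)"

text \<open>A path cut at its rises: a run of horizontal steps in row 0, then for each further row the kind of
  rise that enters it and the run of horizontal steps there. Every path has this form, and the form
  makes the row in which a horizontal step lies visible.\<close>

definition path_of_runs :: "step list \<Rightarrow> (bool \<times> step list) list \<Rightarrow> step list" where
  "path_of_runs g bs = g @ concat (map (\<lambda>(d, h). rise d # h) bs)"

definition horizontal_runs :: "step list \<Rightarrow> (bool \<times> step list) list \<Rightarrow> bool" where
  "horizontal_runs g bs \<longleftrightarrow> set g \<subseteq> {L, R} \<and> (\<forall>b\<in>set bs. set (snd b) \<subseteq> {L, R})"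

lemma path_of_runs_snoc: "path_of_runs g (bs @ [(d, h)]) = (path_of_runs g bs @ [rise d]) @ h"
  by (simp add: path_of_runs_def)

lemma exists_runs: "\<exists>g bs. p = path_of_runs g bs \<and> horizontal_runs g bs"
proof (induction p rule: rev_induct)
  case Nil
  show ?case by (intro exI[of _ "[]"]) (simp add: path_of_runs_def horizontal_runs_def)
next
  case (snoc s p)
  then obtain g bs where p: "p = path_of_runs g bs" and hor: "horizontal_runs g bs" by blast
  consider "s = rise True \<or> s = rise False" | "s \<in> {L, R}"
    by (cases s) (auto simp: rise_def)
  then show ?case
  proof cases
    case 1
    then obtain d where "s = rise d" by blast
    then have "p @ [s] = path_of_runs g (bs @ [(d, [])])" by (simp add: p path_of_runs_snoc)
    moreover have "horizontal_runs g (bs @ [(d, [])])"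
      using hor by (auto simp: horizontal_runs_def)
    ultimately show ?thesis by blast
  next
    case 2
    show ?thesis
    proof (cases bs rule: rev_cases)
      case Nil
      then have "p @ [s] = path_of_runs (g @ [s]) []" by (simp add: p path_of_runs_def)
      moreover have "horizontal_runs (g @ [s]) []"
        using hor 2 by (auto simp: horizontal_runs_def)
      ultimately show ?thesis by blast
    next
      case (snoc bs' b)
      obtain d h where b: "b = (d, h)" by (cases b)
      have "p @ [s] = path_of_runs g (bs' @ [(d, h @ [s])])"
        by (simp add: p snoc b path_of_runs_snoc)
      moreover have "horizontal_runs g (bs' @ [(d, h @ [s])])"
        using hor 2 by (auto simp: horizontal_runs_def snoc b)
      ultimately show ?thesis by blast
    qed
  qed
qed

lemma height_path_of_runs:
  assumes "horizontal_runs g bs"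
  shows "snd (vertex (path_of_runs g bs) (length (path_of_runs g bs))) = int (length bs)"
  using assms unfolding vertex_full
proof (induction bs rule: rev_induct)
  case Nil
  then show ?case
    by (simp add: path_of_runs_def horizontal_runs_def height_horizontal)
next
  case (snoc b bs)
  then show ?case
    by (cases b) (auto simp: path_of_runs_snoc horizontal_runs_def
        height_horizontal rise_def)
qed

lemma has_step_at_path_of_runs:
  assumes "horizontal_runs g bs" "s \<in> {L, R}"
  shows "has_step_at (path_of_runs g bs) s r \<longleftrightarrow>
     (r = 0 \<and> s \<in> set g) \<or> (\<exists>i<length bs. r = Suc i \<and> s \<in> set (snd (bs ! i)))"
  using assms(1)
proof (induction bs rule: rev_induct)
  case Nil
  have "has_step_at ([] @ g) s r \<longleftrightarrow> s \<in> set g \<and> r = 0"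
    using Nil by (subst has_step_at_append_horizontal)
      (auto simp: horizontal_runs_def has_step_at_def vertex_def)
  then show ?case by (auto simp: path_of_runs_def)
next
  case (snoc b bs)
  obtain d h where b: "b = (d, h)" by (cases b)
  have hor: "horizontal_runs g bs" and h: "set h \<subseteq> {L, R}"
    using snoc.prems by (auto simp: horizontal_runs_def b)
  let ?p = "path_of_runs g bs"
  have "snd (vertex (?p @ [rise d]) (length (?p @ [rise d]))) = int (Suc (length bs))"
    using height_path_of_runs[OF hor] unfolding vertex_full by (auto simp: rise_def)
  then have "has_step_at (path_of_runs g (bs @ [b])) s r \<longleftrightarrow>
     has_step_at (?p @ [rise d]) s r \<or> (s \<in> set h \<and> r = Suc (length bs))"
    using has_step_at_append_horizontal[OF h, of "?p @ [rise d]" s r]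
    by (auto simp: b path_of_runs_snoc)
  also have "has_step_at (?p @ [rise d]) s r \<longleftrightarrow> has_step_at ?p s r"
    using assms(2) by (auto simp: has_step_at_snoc rise_def)
  finally have "has_step_at (path_of_runs g (bs @ [b])) s r \<longleftrightarrow>
     (r = 0 \<and> s \<in> set g) \<or> (\<exists>i<length bs. r = Suc i \<and> s \<in> set (snd (bs ! i))) \<or>
     (s \<in> set h \<and> r = Suc (length bs))"
    unfolding snoc.IH[OF hor] by blast
  moreover have "(\<exists>i<length (bs @ [b]). r = Suc i \<and> s \<in> set (snd ((bs @ [b]) ! i))) \<longleftrightarrow>
     (\<exists>i<length bs. r = Suc i \<and> s \<in> set (snd (bs ! i))) \<or> (s \<in> set h \<and> r = Suc (length bs))"
    unfolding length_append_singleton Ex_less_Suc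
    by (simp add: b nth_append cong: conj_cong) blast
  ultimately show ?case by blast
qed

text \<open>The case in which the run in row 0 goes right and all others go left, as the row condition enforces;
  a row is then given by the kind of its rise and its number of left steps.\<close>

definition row_path :: "nat \<Rightarrow> (bool \<times> nat) list \<Rightarrow> step list" where
  "row_path m bs = replicate m R @ concat (map (\<lambda>(d, k). rise d # replicate k L) bs)"

lemma row_path_snoc:
  "row_path m (bs @ [(d, k)]) = (row_path m bs @ [rise d]) @ replicate k L"
  by (simp add: row_path_def)

lemma row_path_eq_path_of_runs:
  "row_path m bs = path_of_runs (replicate m R) (map (apsnd (\<lambda>k. replicate k L)) bs)"
  by (simp add: row_path_def path_of_runs_def comp_def apsnd_def map_prod_def case_prod_unfold)

lemma horizontal_runs_rows:
  "horizontal_runs (replicate m R) (map (apsnd (\<lambda>k. replicate k L)) bs)"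
  by (auto simp: horizontal_runs_def)

lemma has_step_at_L_row_path:
  "has_step_at (row_path m bs) L r \<longleftrightarrow> (\<exists>i<length bs. r = Suc i \<and> 0 < snd (bs ! i))"
  unfolding row_path_eq_path_of_runs has_step_at_path_of_runs[OF horizontal_runs_rows insertI1]
  by auto

lemma has_step_at_R_row_path:
  "has_step_at (row_path m bs) R r \<longleftrightarrow> r = 0 \<and> 0 < m"
  using has_step_at_path_of_runs[OF horizontal_runs_rows[of m bs], of R r]
  unfolding row_path_eq_path_of_runs by auto

lemma sum_list_replicate_pair: "sum_list (replicate k (a, b)) = (int k * a, int k * b)"
  by (induction k) (auto simp: zero_prod_def algebra_simps)

lemma endpoint_row_path:
  "vertex (row_path m bs) (length (row_path m bs)) =
     (int m + (\<Sum>(d, k)\<leftarrow>bs. of_bool d - int k), int (length bs))"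
  unfolding vertex_full
  by (induction bs rule: rev_induct)
    (auto simp: row_path_snoc rise_def sum_list_replicate_pair,
     simp add: row_path_def sum_list_replicate_pair)

lemma count_diagonals_row_path: "count_list (row_path m bs) D = length (filter fst bs)"
proof (induction bs rule: rev_induct)
  case Nil
  show ?case by (induction m) (auto simp: row_path_def)
next
  case (snoc b bs)
  obtain d k where b: "b = (d, k)" by (cases b)
  have "count_list (replicate k L) D = 0" by (induction k) auto
  then show ?case
    using snoc by (auto simp: b row_path_snoc rise_def)
qed

text \<open>The run lengths can be read off greedily, because a run is delimited by rises and no rise is a
  horizontal step.\<close>

lemma row_path_inject:
  assumes "row_path m bs = row_path m' bs'"
  shows "bs = bs'"
proof -
  let ?body = "\<lambda>bs. concat (map (\<lambda>(d, k). rise d # replicate k L) bs)"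
  have dropR: "dropWhile (\<lambda>s. s = R) (row_path m bs) = ?body bs" for m bs
    unfolding row_path_def by (subst dropWhile_append2; cases bs; auto simp: rise_def)
  have takeL: "takeWhile (\<lambda>s. s = L) (replicate k L @ ?body bs) = replicate k L"
    and dropL: "dropWhile (\<lambda>s. s = L) (replicate k L @ ?body bs) = ?body bs" for k bs
    by (subst takeWhile_append2 dropWhile_append2; cases bs; auto simp: rise_def)+
  have "?body bs = ?body bs' \<Longrightarrow> bs = bs'"
  proof (induction bs arbitrary: bs')
    case Nil
    then show ?case by (cases bs') auto
  next
    case (Cons b bs)
    obtain d k where b: "b = (d, k)" by (cases b)
    show ?case
    proof (cases bs')
      case Nil
      then show ?thesis using Cons.prems by (simp add: b)
    next
      case (Cons b' bs'')
      obtain d' k' where b': "b' = (d', k')" by (cases b')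
      have eq: "rise d = rise d'" "replicate k L @ ?body bs = replicate k' L @ ?body bs''"
        using Cons.prems unfolding Cons b b' by auto
      have "replicate k L = replicate k' L" "?body bs = ?body bs''"
        using takeL[of k bs] takeL[of k' bs''] dropL[of k bs] dropL[of k' bs''] eq(2) by auto
      then show ?thesis
        using Cons.IH[of bs''] eq(1)
        by (auto simp: b b' local.Cons rise_def replicate_eq_replicate split: if_splits)
    qed
  qed
  then show ?thesis using dropR[of m bs] dropR[of m' bs'] assms by simp
qed

text \<open>Adds the left step that every row except the last must contain. The last row may be empty, so its
  letter is left alone.\<close>

definition pad :: "(bool \<times> nat) list \<Rightarrow> (bool \<times> nat) list" where
  "pad w = (if w = [] then [] else map (apsnd Suc) (butlast w) @ [last w])"

lemma pad_Nil [simp]: "pad [] = []"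
  by (simp add: pad_def)

lemma pad_snoc [simp]: "pad (w @ [x]) = map (apsnd Suc) w @ [x]"
  by (simp add: pad_def)

lemma length_pad [simp]: "length (pad w) = length w"
  by (cases w rule: rev_cases) simp_all

lemma pad_inject: "pad w = pad w' \<Longrightarrow> w = w'"
proof -
  have inj: "inj (apsnd Suc :: bool \<times> nat \<Rightarrow> _)" by (rule injI) auto
  assume "pad w = pad w'"
  then show ?thesis
    by (cases w rule: rev_cases; cases w' rule: rev_cases)
      (auto dest: map_injective[OF _ inj])
qed

lemma filter_fst_pad [simp]: "length (filter fst (pad w)) = length (filter fst w)"
  by (cases w rule: rev_cases) (simp_all add: filter_map comp_def)

lemma exists_pad:
  assumes "\<And>i. Suc i < length bs \<Longrightarrow> 0 < snd (bs ! i)"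
  shows "\<exists>w. bs = pad w"
proof (cases bs rule: rev_cases)
  case (snoc cs x)
  have "map (apsnd Suc) (map (apsnd (\<lambda>k. k - 1)) cs) = cs"
  proof (rule nth_equalityI)
    fix i assume "i < length (map (apsnd Suc) (map (apsnd (\<lambda>k. k - 1)) cs))"
    then have i: "i < length cs" by simp
    then have "0 < snd (cs ! i)" using assms[of i] by (simp add: snoc nth_append)
    then show "map (apsnd Suc) (map (apsnd (\<lambda>k. k - 1)) cs) ! i = cs ! i"
      using i by (cases "cs ! i") auto
  qed simp
  then show ?thesis unfolding snoc by (metis pad_snoc)
qed (use pad_Nil in metis)

lemma row_condition_row_path_pad: "row_condition (length w) (row_path m (pad w))"
  if "w \<noteq> []"
proof -
  have "0 < snd (pad w ! i)" if "Suc i < length w" for i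
    using that by (cases w rule: rev_cases) (auto simp: nth_append)
  then have "has_step_at (row_path m (pad w)) L r" if "r \<in> {1..<length w}" for r
    using that unfolding has_step_at_L_row_path by (auto intro!: exI[of _ "r - 1"])
  then show ?thesis
    using that by (auto simp: row_condition_def has_step_at_L_row_path has_step_at_R_row_path)
qed

text \<open>Two consecutive horizontal steps lie in the same row, but right steps lie in row 0 and left steps
  above it.\<close>

lemma no_backtrack_row_path: "no_backtrack (row_path m bs)"
  unfolding no_backtrack_def
proof (intro allI impI)
  fix n assume n: "Suc n < length (row_path m bs)"
  let ?p = "row_path m bs"
  have row: "\<exists>r. has_step_at ?p (?p ! k) r \<and> snd (vertex ?p k) = int r"
    if "k < length ?p" for k
  proof -
    have "0 \<le> snd (sum_list (map step_vec q))" for q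
    proof (induction q)
      case (Cons s q) then show ?case by (cases s) auto
    qed simp
    then have "0 \<le> snd (vertex ?p k)" unfolding vertex_def .
    then show ?thesis
      using that unfolding has_step_at_def by (intro exI[of _ "nat (snd (vertex ?p k))"]) auto
  qed
  have next_v: "vertex ?p (Suc n) = vertex ?p n + step_vec (?p ! n)"
    using n by (simp add: vertex_def take_Suc_conv_app_nth)
  obtain r where r: "has_step_at ?p (?p ! n) r" "snd (vertex ?p n) = int r"
    using row[of n] n by auto
  obtain r' where r': "has_step_at ?p (?p ! Suc n) r'" "snd (vertex ?p (Suc n)) = int r'"
    using row[of "Suc n"] n by auto
  show "\<not> (?p ! n = L \<and> ?p ! Suc n = R) \<and> \<not> (?p ! n = R \<and> ?p ! Suc n = L)"
    using r r' next_v by (auto simp: has_step_at_L_row_path has_step_at_R_row_path)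
qed

text \<open>Conversely, the height of the endpoint gives the number of rows, and the row condition excludes one
  horizontal direction from each of them and forces left steps in all rows that \<open>pad\<close> lengthens.\<close>

lemma row_condition_imp_row_path:
  assumes cond: "row_condition l p" and height: "snd (vertex p (length p)) = int l"
  shows "\<exists>m w. length w = l \<and> p = row_path m (pad w)"
proof (cases "l = 0")
  case True
  then have "p = row_path 0 (pad [])" using cond by (simp add: row_condition_def row_path_def)
  then show ?thesis using True by (intro exI[of _ 0] exI[of _ "[]"]) simp
next
  case False
  obtain g bs where p: "p = path_of_runs g bs" and hor: "horizontal_runs g bs"
    using exists_runs by blast
  have len: "length bs = l" using height height_path_of_runs[OF hor] p by simp
  note steps = has_step_at_path_of_runs[OF hor, folded p]
  have "L \<notin> set g" using cond False steps[of L 0] by (simp add: row_condition_def)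
  then have g: "g = replicate (length g) R"
    using hor by (intro replicate_eqI) (auto simp: horizontal_runs_def)
  have noR: "\<not> has_step_at p R (Suc i)" if "i < l" for i
  proof (cases "Suc i = l")
    case True
    then show ?thesis using cond False by (auto simp: row_condition_def)
  next
    case neq: False
    then have "Suc i \<in> {1..<l}" using that by auto
    then show ?thesis using cond False by (auto simp: row_condition_def)
  qed
  have h: "snd b = replicate (length (snd b)) L" if b: "b \<in> set bs" for b
  proof (rule replicate_eqI)
    fix s assume s: "s \<in> set (snd b)"
    obtain i where "i < length bs" "bs ! i = b" using b by (metis in_set_conv_nth)
    then have "R \<notin> set (snd b)" using noR[of i] len steps[of R "Suc i"] by auto
    then show "s = L" using s hor b by (auto simp: horizontal_runs_def)
  qed simp
  define cs where "cs = map (apsnd length) bs"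
  have "map (apsnd (\<lambda>k. replicate k L)) cs = bs"
    unfolding cs_def map_map
  proof (rule map_idI)
    fix b assume "b \<in> set bs"
    from h[OF this, symmetric] show "(apsnd (\<lambda>k. replicate k L) \<circ> apsnd length) b = b"
      by (simp add: prod_eq_iff)
  qed
  then have path: "p = row_path (length g) cs"
    unfolding row_path_eq_path_of_runs g[symmetric] by (simp add: p)
  have "0 < snd (cs ! i)" if "Suc i < length cs" for i
  proof -
    have "Suc i \<in> {1..<l}" using that len by (simp add: cs_def)
    then have "has_step_at p L (Suc i)" using cond False by (auto simp: row_condition_def)
    then show ?thesis unfolding path has_step_at_L_row_path by auto
  qed
  then obtain w where "cs = pad w" using exists_pad by blast
  then show ?thesis using path len by (intro exI[of _ "length g"] exI[of _ w]) (metis cs_def length_map length_pad)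
qed

section \<open>The area between a staircase and a line\<close>

text \<open>The part of the strip \<open>r \<le> y \<le> r + 1\<close> between the line \<open>x = f y\<close> and the line that starts at
  height \<open>r\<close> with abscissa \<open>c\<close> and moves right by \<open>d\<close> per unit of height.\<close>

definition trapezoid :: "real \<Rightarrow> real \<Rightarrow> real \<Rightarrow> real \<Rightarrow> (real \<times> real) set" where
  "trapezoid f c d r = {(x, y). r \<le> y \<and> y \<le> r + 1 \<and> f * y \<le> x \<and> x \<le> c + d * (y - r)}"

definition open_trapezoid :: "real \<Rightarrow> real \<Rightarrow> real \<Rightarrow> real \<Rightarrow> (real \<times> real) set" where
  "open_trapezoid f c d r = {(x, y). r < y \<and> y < r + 1 \<and> f * y < x \<and> x < c + d * (y - r)}"

lemma open_open_trapezoid: "open (open_trapezoid f c d r)"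
proof -
  have "open {z::real \<times> real. r < snd z}" "open {z::real \<times> real. snd z < r + 1}"
    "open {z::real \<times> real. f * snd z < fst z}"
    "open {z::real \<times> real. fst z < c + d * (snd z - r)}"
    by (intro open_Collect_less continuous_intros)+
  then have "open ({z::real \<times> real. r < snd z} \<inter> {z::real \<times> real. snd z < r + 1} \<inter>
     {z::real \<times> real. f * snd z < fst z} \<inter> {z::real \<times> real. fst z < c + d * (snd z - r)})"
    by (intro open_Int)
  also have "\<dots> = open_trapezoid f c d r"
    by (auto simp: open_trapezoid_def)
  finally show ?thesis .
qed

lemma compact_trapezoid: "compact (trapezoid f c d r)"
proof -
  have "closed {z::real \<times> real. r \<le> snd z}" "closed {z::real \<times> real. snd z \<le> r + 1}"
    "closed {z::real \<times> real. f * snd z \<le> fst z}"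
    "closed {z::real \<times> real. fst z \<le> c + d * (snd z - r)}"
    by (intro closed_Collect_le continuous_intros)+
  then have "closed ({z::real \<times> real. r \<le> snd z} \<inter> {z::real \<times> real. snd z \<le> r + 1} \<inter>
     {z::real \<times> real. f * snd z \<le> fst z} \<inter> {z::real \<times> real. fst z \<le> c + d * (snd z - r)})"
    by (intro closed_Int)
  also have "\<dots> = trapezoid f c d r"
    by (auto simp: trapezoid_def)
  finally have cl: "closed (trapezoid f c d r)" .
  have "trapezoid f c d r \<subseteq>
      {- (\<bar>f\<bar> * (\<bar>r\<bar> + 1)) .. \<bar>c\<bar> + \<bar>d\<bar>} \<times> {r .. r + 1}"
  proof (clarsimp simp: trapezoid_def)
    fix x y assume y: "r \<le> y" "y \<le> r + 1" and x: "f * y \<le> x" "x \<le> c + d * (y - r)"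
    have "\<bar>d * (y - r)\<bar> \<le> \<bar>d\<bar> * 1"
      unfolding abs_mult using y by (intro mult_left_mono) auto
    moreover have "\<bar>f * y\<bar> \<le> \<bar>f\<bar> * (\<bar>r\<bar> + 1)"
      unfolding abs_mult using y by (intro mult_left_mono) auto
    ultimately show "- (\<bar>f\<bar> * (\<bar>r\<bar> + 1)) \<le> x \<and> x \<le> \<bar>c\<bar> + \<bar>d\<bar>"
      using x by linarith
  qed
  moreover have "bounded ({- (\<bar>f\<bar> * (\<bar>r\<bar> + 1)) .. \<bar>c\<bar> + \<bar>d\<bar>} \<times> {r .. r + 1})"
    by (intro bounded_Times bounded_closed_interval)
  ultimately have "bounded (trapezoid f c d r)" 
    using bounded_subset by blast
  with cl show ?thesis by (simp add: compact_eq_bounded_closed)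
qed

text \<open>The width is affine in the height, hence a convex combination of the two boundary widths.\<close>

lemma trapezoid_width_nonneg:
  assumes "f * r \<le> c" "f * (r + 1) \<le> c + d" "r \<le> y" "y \<le> r + 1"
  shows "f * y \<le> c + d * (y - r :: real)"
proof -
  have "0 \<le> (1 - (y - r)) * (c - f * r) + (y - r) * (c + d - f * (r + 1))"
    using assms by (intro add_nonneg_nonneg mult_nonneg_nonneg) auto
  then show ?thesis by (simp add: algebra_simps)
qed

text \<open>Covers closed and open trapezoids at once: their horizontal sections have the same length except at
  the two boundary heights, which form a null set.\<close>

lemma emeasure_between_lines:
  fixes S :: "(real \<times> real) set"
  assumes S: "S \<in> sets borel"
    and lo: "f * r \<le> c" "f * (r + 1) \<le> c + d"
    and sec: "\<And>y. y \<noteq> r \<Longrightarrow> y \<noteq> r + 1 \<Longrightarrow> emeasure lborel ((\<lambda>x. (x, y)) -` S) =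
       ennreal (c + d * (y - r) - f * y) * indicator {r .. r + 1} y"
  shows "emeasure lborel S = ennreal (((c - f * r) + (c + d - f * (r + 1))) / 2)"
proof -
  define F where "F = (\<lambda>y. c * y + d * (y - r)^2 / 2 - f * y^2 / 2)"
  have "emeasure lborel S = emeasure (lborel \<Otimes>\<^sub>M lborel) S"
    by (simp add: lborel_prod)
  also have "\<dots> = (\<integral>\<^sup>+y. emeasure lborel ((\<lambda>x. (x, y)) -` S) \<partial>lborel)"
    using S by (intro lborel_pair.emeasure_pair_measure_alt2) (simp only: lborel_prod sets_lborel)
  also have "\<dots> = (\<integral>\<^sup>+y. ennreal (c + d * (y - r) - f * y) * indicator {r .. r + 1} y \<partial>lborel)"
  proof (rule nn_integral_cong_AE)
    have "AE y in lborel. y \<noteq> r \<and> y \<noteq> r + 1"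
      using AE_lborel_singleton[of r] AE_lborel_singleton[of "r + 1"] by eventually_elim auto
    then show "AE y in lborel. emeasure lborel ((\<lambda>x. (x, y)) -` S) =
       ennreal (c + d * (y - r) - f * y) * indicator {r .. r + 1} y"
      by eventually_elim (simp add: sec)
  qed
  also have "\<dots> = ennreal (F (r + 1) - F r)"
  proof (rule nn_integral_FTC_Icc)
    fix y assume y: "y \<in> {r .. r + 1}"
    show "(F has_real_derivative c + d * (y - r) - f * y) (at y)"
      unfolding F_def by (auto intro!: derivative_eq_intros)
    show "0 \<le> c + d * (y - r) - f * y"
      using trapezoid_width_nonneg[OF lo, of y] y by simp
  qed auto
  also have "F (r + 1) - F r = ((c - f * r) + (c + d - f * (r + 1))) / 2"
    by (simp add: F_def power2_eq_square field_simps)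
  finally show ?thesis .
qed

lemma emeasure_trapezoid:
  assumes "f * r \<le> c" "f * (r + 1) \<le> c + d"
  shows "emeasure lborel (trapezoid f c d r) = ennreal (((c - f * r) + (c + d - f * (r + 1))) / 2)"
proof (rule emeasure_between_lines[OF _ assms])
  show "trapezoid f c d r \<in> sets borel"
    using compact_trapezoid borel_compact by blast
  fix y :: real
  have "(\<lambda>x. (x, y)) -` trapezoid f c d r =
     (if r \<le> y \<and> y \<le> r + 1 then {f * y .. c + d * (y - r)} else {})"
    by (auto simp: trapezoid_def)
  then show "emeasure lborel ((\<lambda>x. (x, y)) -` trapezoid f c d r) =
       ennreal (c + d * (y - r) - f * y) * indicator {r .. r + 1} y"
    using trapezoid_width_nonneg[OF assms, of y] by auto
qed

lemma emeasure_open_trapezoid: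
  assumes "f * r \<le> c" "f * (r + 1) \<le> c + d"
  shows "emeasure lborel (open_trapezoid f c d r) =
    ennreal (((c - f * r) + (c + d - f * (r + 1))) / 2)"
proof (rule emeasure_between_lines[OF _ assms])
  show "open_trapezoid f c d r \<in> sets borel"
    using open_open_trapezoid by simp
  fix y :: real assume "y \<noteq> r" "y \<noteq> r + 1"
  moreover have "(\<lambda>x. (x, y)) -` open_trapezoid f c d r =
     (if r < y \<and> y < r + 1 then {f * y <..< c + d * (y - r)} else {})"
    by (auto simp: open_trapezoid_def)
  ultimately show "emeasure lborel ((\<lambda>x. (x, y)) -` open_trapezoid f c d r) =
       ennreal (c + d * (y - r) - f * y) * indicator {r .. r + 1} y"
    using trapezoid_width_nonneg[OF assms, of y] by (auto simp: indicator_def)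
qed

text \<open>The set traced by a path that runs along row 0 up to \<open>c 0\<close>, leaves row \<open>r\<close> at abscissa \<open>c r\<close>, moves
  right by \<open>d r\<close> while rising to row \<open>r + 1\<close>, and then runs left to \<open>c (r + 1)\<close>.\<close>

definition staircase :: "nat \<Rightarrow> (nat \<Rightarrow> real) \<Rightarrow> (nat \<Rightarrow> real) \<Rightarrow> (real \<times> real) set" where
  "staircase n c d = {0..c 0} \<times> {0} \<union>
     (\<Union>r<n. {(x, y). r \<le> y \<and> y \<le> r + 1 \<and> x = c r + d r * (y - r)} \<union>
            {c (Suc r)..c r + d r} \<times> {real r + 1})"

lemma staircase_Suc:
  "staircase (Suc n) c d = staircase n c d \<union>
     {(x, y). n \<le> y \<and> y \<le> n + 1 \<and> x = c n + d n * (y - n)} \<union>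
     {c (Suc n)..c n + d n} \<times> {real n + 1}"
  by (auto simp: staircase_def lessThan_Suc)

lemma unbounded_ray:
  fixes x y s :: real
  assumes "s \<noteq> 0" and ray: "\<And>t. 0 \<le> t \<Longrightarrow> (x + s * t, y) \<notin> S"
  shows "(x, y) \<notin> inside S"
proof
  assume "(x, y) \<in> inside S"
  then have bdd: "bounded (connected_component_set (- S) (x, y))" by (simp add: inside_def)
  let ?R = "(\<lambda>t. (x + s * t, y)) ` {0..}"
  have "connected ?R"
    by (intro connected_continuous_image continuous_intros) simp
  moreover have "(x, y) \<in> ?R" by (rule image_eqI[of _ _ 0]) auto
  moreover have "?R \<subseteq> - S" using ray by auto
  ultimately have "?R \<subseteq> connected_component_set (- S) (x, y)"
    by (intro connected_component_maximal)
  then have "bounded ?R" using bdd bounded_subset by blast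
  then have "bounded (fst ` ?R)" by (rule bounded_fst)
  then obtain B where B: "\<And>t. 0 \<le> t \<Longrightarrow> \<bar>x + s * t\<bar> \<le> B"
    by (auto simp: bounded_iff)
  define t where "t = (\<bar>B\<bar> + \<bar>x\<bar> + 1) / \<bar>s\<bar>"
  have "\<bar>s * t\<bar> = \<bar>B\<bar> + \<bar>x\<bar> + 1" using assms(1) by (simp add: t_def abs_mult)
  moreover have "0 \<le> t" by (simp add: t_def)
  ultimately show False using B[of t] by linarith
qed

text \<open>A staircase that stays right of the line \<open>x = f y\<close> and ends on it. The region enclosed by the two is
  sandwiched: it contains \<open>core\<close>, an open set built from open trapezoids, and it is contained in
  \<open>region\<close>, the union of the closed trapezoids. Both sides have the same measure.\<close>

locale closed_staircase =
  fixes f :: real and l :: nat and c d :: "nat \<Rightarrow> real"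
  assumes f_pos: "0 < f"
    and right: "\<And>r. r \<le> l \<Longrightarrow> f * r \<le> c r"
    and retreat: "\<And>r. r < l \<Longrightarrow> c (Suc r) \<le> c r + d r"
    and final: "c l = f * l"
begin

lemma right': "r < l \<Longrightarrow> f * (real r + 1) \<le> c r + d r"
  using right[of "Suc r"] retreat[of r] by (simp add: algebra_simps)

definition barrier where "barrier = staircase l c d \<union> {(x, y). y = x / f}"

definition region where "region = (\<Union>r<l. trapezoid f (c r) (d r) r)"

text \<open>Open trapezoids alone miss the horizontal segments along which neighbouring trapezoids meet. The
  second union adds a neighbourhood of each such segment, obtained by prolonging both bounding
  slanted lines, so that \<open>core\<close> is open and exhausts \<open>region\<close> up to the barrier.\<close>

definition core where
  "core = (\<Union>r<l. open_trapezoid f (c r) (d r) r) \<union>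
     (\<Union>r\<in>{1..<l}. {(x, y). real r - 1 < y \<and> y < r + 1 \<and> f * y < x \<and>
        x < c (r - 1) + d (r - 1) * (y - (real r - 1)) \<and> x < c r + d r * (y - r)})"

lemma compact_region: "compact region"
  unfolding region_def by (intro compact_UN compact_trapezoid) auto

lemma open_core: "open core"
proof -
  have "open {(x, y). real r - 1 < y \<and> y < r + 1 \<and> f * y < x \<and>
        x < c (r - 1) + d (r - 1) * (y - (real r - 1)) \<and> x < c r + d r * (y - r)}" for r :: nat
    unfolding case_prod_unfold
    by (intro open_Collect_conj open_Collect_less continuous_intros)
  then show ?thesis
    unfolding core_def by (intro open_Un open_UN ballI open_open_trapezoid)
qed

lemma staircase_subset_region: "staircase l c d \<subseteq> region \<union> {(x, y). y = x / f}"
proof (rule subrelI)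
  fix x y assume "(x, y) \<in> staircase l c d"
  then consider (base) "0 \<le> x" "x \<le> c 0" "y = 0"
    | (rise) r where "r < l" "real r \<le> y" "y \<le> real r + 1" "x = c r + d r * (y - r)"
    | (retreat) r where "r < l" "c (Suc r) \<le> x" "x \<le> c r + d r" "y = real r + 1"
    by (auto simp: staircase_def)
  then show "(x, y) \<in> region \<union> {(x, y). y = x / f}"
  proof cases
    case base
    show ?thesis
    proof (cases "l = 0")
      case True
      then show ?thesis using base final by auto
    next
      case False
      then have "(x, y) \<in> trapezoid f (c 0) (d 0) (real 0)"
        using base by (auto simp: trapezoid_def)
      then show ?thesis using False unfolding region_def by blast
    qed
  next
    case (rise r)
    have "f * y \<le> c r + d r * (y - real r)"
      using trapezoid_width_nonneg[OF right[of r] right'[of r]] rise by simp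
    then have "(x, y) \<in> trapezoid f (c r) (d r) r"
      using rise by (auto simp: trapezoid_def)
    then show ?thesis using rise(1) unfolding region_def by blast
  next
    case (retreat r)
    have "f * y \<le> c (Suc r)"
      using right[of "Suc r"] retreat(1,4) by (simp add: algebra_simps)
    then have "(x, y) \<in> trapezoid f (c r) (d r) r"
      using retreat by (auto simp: trapezoid_def)
    then show ?thesis using retreat(1) unfolding region_def by blast
  qed
qed

lemma region_right_of_line: "(x, y) \<in> region \<Longrightarrow> f * y \<le> x"
  by (auto simp: region_def trapezoid_def)

lemma staircase_right_of_line: "(x, y) \<in> staircase l c d \<Longrightarrow> f * y \<le> x"
proof -
  assume "(x, y) \<in> staircase l c d"
  then consider "(x, y) \<in> region" | "y = x / f" using staircase_subset_region by auto
  then show ?thesis using region_right_of_line[of x y] f_pos by cases (auto simp: field_simps)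
qed

lemma core_subset_region: "core \<subseteq> region"
proof (rule subrelI)
  fix x y assume "(x, y) \<in> core"
  then consider r where "r < l" "(x, y) \<in> open_trapezoid f (c r) (d r) r"
    | r where "r \<in> {1..<l}" "real r - 1 < y" "y < r + 1" "f * y < x"
        "x < c (r - 1) + d (r - 1) * (y - (real r - 1))" "x < c r + d r * (y - r)"
    unfolding core_def by blast
  then show "(x, y) \<in> region"
  proof cases
    case (1 r)
    then have "(x, y) \<in> trapezoid f (c r) (d r) r"
      by (auto simp: open_trapezoid_def trapezoid_def)
    then show ?thesis using 1(1) unfolding region_def by blast
  next
    case (2 r)
    show ?thesis
    proof (cases "y \<le> r")
      case True
      then have "(x, y) \<in> trapezoid f (c (r - 1)) (d (r - 1)) (real (r - 1))"
        using 2 by (auto simp: trapezoid_def of_nat_diff)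
      moreover have "r - 1 < l" using 2(1) by auto
      ultimately show ?thesis unfolding region_def by blast
    next
      case False
      then have "(x, y) \<in> trapezoid f (c r) (d r) r"
        using 2 by (auto simp: trapezoid_def)
      then show ?thesis using 2(1) unfolding region_def by auto
    qed
  qed
qed

lemma region_subset_core_barrier: "region \<subseteq> core \<union> barrier"
proof (rule subrelI)
  fix x y assume "(x, y) \<in> region"
  then obtain r where r: "r < l" "real r \<le> y" "y \<le> real r + 1" "f * y \<le> x"
      "x \<le> c r + d r * (y - r)"
    by (auto simp: region_def trapezoid_def)
  have rise: "(x, y) \<in> staircase l c d" if "x = c r + d r * (y - r)"
    using that r by (auto simp: staircase_def)
  have line: "(x, y) \<in> barrier" if "f * y = x"
    using that f_pos by (auto simp: barrier_def)
  have row: "(x, real k) \<in> core \<union> barrier"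
    if k: "1 \<le> k" "k < l" "f * k < x" "x \<le> c (k - 1) + d (k - 1)" for k
  proof (cases "x < c k")
    case True
    have "c k \<le> c (k - 1) + d (k - 1)" using retreat[of "k - 1"] k by simp
    then have "(x, real k) \<in> core"
      using True k unfolding core_def by (auto intro!: bexI[of _ k])
    then show ?thesis by simp
  next
    case False
    then have "(x, real k) \<in> staircase l c d"
      using k by (auto simp: staircase_def of_nat_diff intro!: bexI[of _ "k - 1"])
    then show ?thesis by (simp add: barrier_def)
  qed
  consider "f * y = x" | "x = c r + d r * (y - r)"
    | (inner) "f * y < x" "x < c r + d r * (y - r)" "real r < y" "y < real r + 1"
    | (bottom) "f * y < x" "x < c r" "y = real r"
    | (top) "f * y < x" "x < c r + d r" "y = real r + 1"
    using r by (cases "y = real r"; cases "y = real r + 1") force+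
  then show "(x, y) \<in> core \<union> barrier"
  proof cases
    case 1 then show ?thesis using line by simp
  next
    case 2 then show ?thesis using rise by (simp add: barrier_def)
  next
    case inner
    then show ?thesis using r(1) by (auto simp: core_def open_trapezoid_def)
  next
    case bottom
    show ?thesis
    proof (cases "r = 0")
      case True
      then show ?thesis using bottom by (auto simp: barrier_def staircase_def)
    next
      case False
      then have "c r \<le> c (r - 1) + d (r - 1)" using retreat[of "r - 1"] r(1) by simp
      then show ?thesis using row[of r] bottom r(1) False by simp
    qed
  next
    case top
    show ?thesis
    proof (cases "Suc r = l")
      case True
      then have "c (Suc r) \<le> x" using final top by (auto simp: algebra_simps)
      then have "(x, y) \<in> staircase l c d"
        using top r(1) by (auto simp: staircase_def)
      then show ?thesis by (simp add: barrier_def)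
    next
      case False
      then show ?thesis using row[of "Suc r"] top r(1) by (auto simp: algebra_simps)
    qed
  qed
qed

lemma core_disjoint_barrier: "core \<inter> barrier = {}"
proof -
  have "(x, y) \<notin> barrier" if core: "(x, y) \<in> core" for x y
  proof -
    have xy: "f * y < x" using core by (auto simp: core_def open_trapezoid_def)
    have below: "x < c r + d r * (y - r)" if "r < l" "real r < y" "y < r + 1" for r
    proof -
      from core consider k where "k < l" "(x, y) \<in> open_trapezoid f (c k) (d k) k"
        | k where "k \<in> {1..<l}" "real k - 1 < y" "y < k + 1"
        "x < c (k - 1) + d (k - 1) * (y - (real k - 1))" "x < c k + d k * (y - k)"
        unfolding core_def by blast
      then show ?thesis
      proof cases
        case (1 k)
        then have "k = r" using that by (auto simp: open_trapezoid_def)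
        then show ?thesis using 1 by (auto simp: open_trapezoid_def)
      next
        case (2 k)
        then have "k = r \<or> k = Suc r" using that by auto
        then show ?thesis using 2 by auto
      qed
    qed
    \<comment> \<open>At integer heights only the prolonged neighbourhoods contribute, and these lie left of both lines.\<close>
    have row: "0 < r \<and> r < l \<and> x < c r \<and> x < c (r - 1) + d (r - 1)" if "y = real r" for r
    proof -
      from core consider k where "k < l" "(x, y) \<in> open_trapezoid f (c k) (d k) k"
        | k where "k \<in> {1..<l}" "real k - 1 < y" "y < k + 1"
        "x < c (k - 1) + d (k - 1) * (y - (real k - 1))" "x < c k + d k * (y - k)"
        unfolding core_def by blast
      then show ?thesis
      proof cases
        case (1 k)
        then show ?thesis using that by (auto simp: open_trapezoid_def)
      next
        case (2 k)
        have kr: "k = r"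
        proof -
          have "real k < real (Suc r)" "real r < real (Suc k)" using 2(2,3) that by auto
          then show ?thesis by linarith
        qed
        show ?thesis using 2(1,4,5) unfolding kr that by (auto simp: of_nat_diff)
      qed
    qed
    have "(x, y) \<notin> staircase l c d"
    proof
      assume "(x, y) \<in> staircase l c d"
      then consider (base) "y = 0"
        | (rise) r where "r < l" "real r \<le> y" "y \<le> real r + 1" "x = c r + d r * (y - r)"
        | (retreat) r where "r < l" "c (Suc r) \<le> x" "y = real r + 1"
        by (auto simp: staircase_def)
      then show False
      proof cases
        case base
        then show False using row[of 0] by simp
      next
        case (rise r)
        then consider "real r < y" "y < real r + 1" | "y = real r" | "y = real (Suc r)"
          by fastforce
        then show False
        proof cases
          case 1
          then show False using below[OF rise(1)] rise(4) by simp
        next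
          case 2
          then show False using row[of r] rise(4) by simp
        next
          case 3
          then show False using row[of "Suc r"] rise(4) by simp
        qed
      next
        case (retreat r)
        then show False using row[of "Suc r"] by auto
      qed
    qed
    then show ?thesis using xy f_pos by (auto simp: barrier_def field_simps)
  qed
  then show ?thesis by auto
qed

text \<open>In the complement of the barrier, \<open>core\<close> and the complement of \<open>region\<close> are disjoint open sets that
  cover everything; a component meeting \<open>core\<close> therefore stays in \<open>region\<close> and is bounded.\<close>

lemma core_subset_inside: "core \<subseteq> inside barrier"
proof
  fix p assume p: "p \<in> core"
  let ?C = "connected_component_set (- barrier) p"
  have "p \<notin> barrier" using p core_disjoint_barrier by auto
  have sub: "?C \<subseteq> - barrier" by (rule connected_component_subset)
  have "open (- region)" using compact_region compact_imp_closed by blast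
  moreover have "core \<inter> - region \<inter> ?C = {}" using core_subset_region by blast
  moreover have "?C \<subseteq> core \<union> - region" using sub region_subset_core_barrier by blast
  ultimately have "core \<inter> ?C = {} \<or> - region \<inter> ?C = {}"
    using connectedD[OF connected_connected_component open_core] by blast
  moreover have "p \<in> ?C" using \<open>p \<notin> barrier\<close> by simp
  ultimately have "?C \<subseteq> region" using p by blast
  then have "bounded ?C"
    using compact_region compact_imp_bounded bounded_subset by blast
  then show "p \<in> inside barrier"
    using \<open>p \<notin> barrier\<close> by (simp add: inside_def)
qed

text \<open>A point outside \<open>region\<close> escapes along a horizontal ray: to the left if it lies left of the line,
  and to the right otherwise.\<close>

lemma inside_subset_region: "inside barrier \<subseteq> region"
proof (rule subrelI, rule ccontr)
  fix x y assume ins: "(x, y) \<in> inside barrier" and out: "(x, y) \<notin> region"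
  have "(x, y) \<notin> barrier" using ins by (simp add: inside_def)
  then have "x \<noteq> f * y" using f_pos by (auto simp: barrier_def)
  then consider "x < f * y" | "f * y < x" by linarith
  then show False
  proof cases
    case 1
    have "(x + (- 1) * t, y) \<notin> barrier" if "0 \<le> t" for t
      using staircase_right_of_line[of "x - t" y] 1 that f_pos
      by (auto simp: barrier_def field_simps)
    then show False using unbounded_ray[of "- 1" x y barrier] ins by simp
  next
    case 2
    have "(x + 1 * t, y) \<notin> barrier" if "0 \<le> t" for t
    proof -
      have "(x + t, y) \<notin> region"
        using out 2 that by (auto simp: region_def trapezoid_def)
      then show ?thesis
        using staircase_subset_region 2 that f_pos by (auto simp: barrier_def field_simps)
    qed
    then show False using unbounded_ray[of 1 x y barrier] ins by simp
  qed
qed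

lemma area_staircase:
  "measure lborel (inside barrier) =
     (\<Sum>r<l. ((c r - f * r) + (c r + d r - f * (real r + 1))) / 2)" (is "_ = (\<Sum>r<l. ?a r)")
proof -
  have nonneg: "0 \<le> ?a r" if "r < l" for r
    using right[of r] right'[of r] that by simp
  have S: "(\<Sum>r<l. ennreal (?a r)) = ennreal (\<Sum>r<l. ?a r)"
    using nonneg by (intro sum_ennreal) auto
  have "closed (staircase l c d)"
  proof -
    have "closed {(x, y). real r \<le> y \<and> y \<le> real r + 1 \<and> x = c r + d r * (y - r)}" for r
      unfolding case_prod_unfold
      by (intro closed_Collect_conj closed_Collect_le closed_Collect_eq continuous_intros)
    then show ?thesis
      unfolding staircase_def
      by (intro closed_Un closed_UN closed_Times ballI finite_lessThan closed_atLeastAtMost closed_singleton)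
  qed
  moreover have "closed {(x, y). y = x / f}"
    unfolding case_prod_unfold divide_inverse by (intro closed_Collect_eq continuous_intros)
  ultimately have "open (inside barrier)"
    unfolding barrier_def by (intro open_inside closed_Un)
  then have meas: "inside barrier \<in> sets lborel" by simp
  have "emeasure lborel (inside barrier) \<le> emeasure lborel region"
    using inside_subset_region borel_compact[OF compact_region] by (intro emeasure_mono) auto
  also have "\<dots> \<le> (\<Sum>r<l. emeasure lborel (trapezoid f (c r) (d r) r))"
    unfolding region_def using borel_compact[OF compact_trapezoid]
    by (intro emeasure_subadditive_finite) auto
  also have "\<dots> = (\<Sum>r<l. ennreal (?a r))"
    using right right' by (intro sum.cong refl emeasure_trapezoid) auto
  finally have upper: "emeasure lborel (inside barrier) \<le> ennreal (\<Sum>r<l. ?a r)"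
    using S by simp
  have "disjoint_family_on (\<lambda>r. open_trapezoid f (c r) (d r) r) {..<l}"
    unfolding disjoint_family_on_def
  proof (intro ballI impI)
    fix i j assume "i \<noteq> (j :: nat)"
    then have "real i + 1 \<le> real j \<or> real j + 1 \<le> real i" by linarith
    then show "open_trapezoid f (c i) (d i) i \<inter> open_trapezoid f (c j) (d j) j = {}"
      by (auto simp: open_trapezoid_def)
  qed
  then have "(\<Sum>r<l. emeasure lborel (open_trapezoid f (c r) (d r) r)) =
      emeasure lborel (\<Union>r<l. open_trapezoid f (c r) (d r) r)"
    using open_open_trapezoid by (intro sum_emeasure) auto
  also have "\<dots> \<le> emeasure lborel (inside barrier)"
    using core_subset_inside meas by (intro emeasure_mono) (auto simp: core_def)
  finally have "ennreal (\<Sum>r<l. ?a r) \<le> emeasure lborel (inside barrier)"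
    using emeasure_open_trapezoid[OF right right'] S by simp
  with upper have "emeasure lborel (inside barrier) = ennreal (\<Sum>r<l. ?a r)" by simp
  then show ?thesis
    using nonneg by (simp only: measure_def) (intro enn2real_ennreal sum_nonneg; simp)
qed

end

section \<open>Counting slack words by area\<close>

text \<open>Row \<open>i\<close> contributes its left steps to the widths of the \<open>i + 1\<close> strips at or below its rise, and each
  of these widths enters the doubled area twice. The deficit \<open>f - d\<close> of the rise enters once
  less: in its own strip it widens the lower end but not the upper one.\<close>

definition twice_area :: "nat \<Rightarrow> (bool \<times> nat) list \<Rightarrow> nat" where
  "twice_area f bs = (\<Sum>i<length bs.
     2 * (i + 1) * snd (bs ! i) + (2 * i + 1) * (f - of_bool (fst (bs ! i))))"

lemma twice_area_Nil [simp]: "twice_area f [] = 0"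
  by (simp add: twice_area_def)

lemma twice_area_snoc:
  "twice_area f (bs @ [(d, k)]) = twice_area f bs +
     2 * (length bs + 1) * k + (2 * length bs + 1) * (f - of_bool d)"
  by (simp add: twice_area_def nth_append)

lemma twice_area_map_Suc:
  "twice_area f (map (apsnd Suc) w) = twice_area f (pad w) + 2 * length w"
proof (cases w rule: rev_cases)
  case (snoc w' x)
  then show ?thesis by (cases x) (simp add: twice_area_snoc)
qed simp

lemma twice_area_pad_Suc:
  "twice_area f (pad (w @ [(d, Suc k)])) =
     twice_area f (pad (w @ [(d, k)])) + 2 * Suc (length w)"
  by (simp add: twice_area_snoc)

lemma twice_area_pad_0:
  "twice_area f (pad (w @ [(d, 0)])) =
     twice_area f (pad w) + 2 * length w + (2 * length w + 1) * (f - of_bool d)"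
  by (simp add: twice_area_snoc twice_area_map_Suc)

lemma le_twice_area: "(d, k) \<in> set bs \<Longrightarrow> k \<le> twice_area f bs"
proof (induction bs rule: rev_induct)
  case (snoc b bs)
  then show ?case by (cases b) (auto simp: twice_area_snoc)
qed simp

lemma le_twice_area_pad: "(d, k) \<in> set w \<Longrightarrow> k \<le> twice_area f (pad w)"
proof (cases w rule: rev_cases)
  case (snoc w' x)
  assume "(d, k) \<in> set w"
  then have "(d, k) \<in> set (pad w) \<or> (d, Suc k) \<in> set (pad w)"
    by (auto simp: snoc image_iff intro!: bexI[of _ "(d, k)"])
  then show ?thesis using le_twice_area by (meson Suc_leD)
qed simp

definition slack_words :: "nat \<Rightarrow> nat \<Rightarrow> nat \<Rightarrow> nat \<Rightarrow> (bool \<times> nat) list set" where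
  "slack_words f l j n = {w. length w = l \<and> twice_area f (pad w) = j \<and> length (filter fst w) = n}"

text \<open>A left step costs area, so a bound on the area bounds every letter.\<close>

lemma finite_slack_words: "finite (slack_words f l j n)"
proof (rule finite_subset)
  show "slack_words f l j n \<subseteq> {w. set w \<subseteq> UNIV \<times> {..j} \<and> length w = l}"
    using le_twice_area_pad by (fastforce simp: slack_words_def)
  show "finite {w. set w \<subseteq> (UNIV :: bool set) \<times> {..j} \<and> length w = l}"
    by (intro finite_lists_length_eq) simp
qed

text \<open>Adding a left step to the last row is the map behind the term \<open>h(q\<^sup>2 x)\<close>.\<close>

definition lengthen_last :: "(bool \<times> nat) list \<Rightarrow> (bool \<times> nat) list" where
  "lengthen_last w = butlast w @ [apsnd Suc (last w)]"

lemma inj_on_lengthen_last: "inj_on lengthen_last (slack_words f (Suc l) j n)"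
proof (rule inj_onI)
  fix w w' assume "w \<in> slack_words f (Suc l) j n" "w' \<in> slack_words f (Suc l) j n"
    and eq: "lengthen_last w = lengthen_last w'"
  then show "w = w'"
    by (cases w rule: rev_cases; cases w' rule: rev_cases)
      (auto simp: slack_words_def lengthen_last_def prod_eq_iff)
qed

text \<open>The three summands count the words whose last letter has positive slack, is an up rise with slack 0,
  or is a diagonal rise with slack 0. Deleting a last letter turns the row before it into the last
  one, which loses its forced left step; the area of this step is part of the offsets.\<close>

lemma card_slack_words_Suc:
  assumes "f \<ge> 1"
  shows "card (slack_words f (Suc l) j n) =
     (if 2 * Suc l \<le> j then card (slack_words f (Suc l) (j - 2 * Suc l) n) else 0) +
     (if f + 2 * (f + 1) * l \<le> j then card (slack_words f l (j - (f + 2 * (f + 1) * l)) n) else 0) +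
     (if f - 1 + 2 * f * l \<le> j \<and> 1 \<le> n
      then card (slack_words f l (j - (f - 1 + 2 * f * l)) (n - 1)) else 0)"
proof -
  define A where "A = (if 2 * Suc l \<le> j then slack_words f (Suc l) (j - 2 * Suc l) n else {})"
  define B where "B = (if f + 2 * (f + 1) * l \<le> j
     then slack_words f l (j - (f + 2 * (f + 1) * l)) n else {})"
  define C where "C = (if f - 1 + 2 * f * l \<le> j \<and> 1 \<le> n
     then slack_words f l (j - (f - 1 + 2 * f * l)) (n - 1) else {})"
  let ?b = "\<lambda>w. w @ [(False, 0)]" and ?c = "\<lambda>w. w @ [(True, 0)]"
  \<comment> \<open>The cost of the deleted letter matches the exponents produced by the two dilations.\<close>
  have up: "2 * l + (2 * l + 1) * (f - of_bool False) = f + 2 * (f + 1) * l"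
    by (simp add: algebra_simps)
  have diag: "2 * l + (2 * l + 1) * (f - of_bool True) = f - 1 + 2 * f * l"
  proof -
    obtain g where "f = Suc g" using assms by (cases f) auto
    then show ?thesis by (simp add: algebra_simps)
  qed
  have memA: "w @ [(d, Suc k)] \<in> slack_words f (Suc l) j n \<longleftrightarrow> w @ [(d, k)] \<in> A" for w d k
    unfolding A_def slack_words_def mem_Collect_eq twice_area_pad_Suc by (cases d) auto
  have memB: "w @ [(False, 0)] \<in> slack_words f (Suc l) j n \<longleftrightarrow> w \<in> B" for w
    unfolding B_def slack_words_def mem_Collect_eq twice_area_pad_0 up[symmetric] by auto
  have memC: "w @ [(True, 0)] \<in> slack_words f (Suc l) j n \<longleftrightarrow> w \<in> C" for w
    unfolding C_def slack_words_def mem_Collect_eq twice_area_pad_0 diag[symmetric] by auto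
  have nonempty: "w \<noteq> []" if "w \<in> A" for w
    using that by (auto simp: A_def slack_words_def split: if_splits)
  have "slack_words f (Suc l) j n = lengthen_last ` A \<union> (?b ` B \<union> ?c ` C)"
  proof (intro set_eqI iffI)
    fix v assume v: "v \<in> slack_words f (Suc l) j n"
    then obtain w d k where v_eq: "v = w @ [(d, k)]"
      by (cases v rule: rev_cases) (auto simp: slack_words_def)
    show "v \<in> lengthen_last ` A \<union> (?b ` B \<union> ?c ` C)"
    proof (cases k)
      case 0
      then show ?thesis using v memB[of w] memC[of w] by (cases d) (auto simp: v_eq)
    next
      case (Suc k')
      then have "w @ [(d, k')] \<in> A" using v memA by (simp add: v_eq)
      moreover have "v = lengthen_last (w @ [(d, k')])" by (simp add: lengthen_last_def v_eq Suc)
      ultimately show ?thesis by blast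
    qed
  next
    fix v assume "v \<in> lengthen_last ` A \<union> (?b ` B \<union> ?c ` C)"
    then consider w where "w \<in> A" "v = lengthen_last w" | w where "w \<in> B" "v = ?b w"
      | w where "w \<in> C" "v = ?c w" by blast
    then show "v \<in> slack_words f (Suc l) j n"
    proof cases
      case (1 w)
      then obtain u d k where "w = u @ [(d, k)]"
        using nonempty by (metis rev_exhaust surj_pair)
      then show ?thesis using 1 memA[of u d k] by (simp add: lengthen_last_def)
    qed (use memB memC in auto)
  qed
  moreover have "finite A" "finite B" "finite C"
    using finite_slack_words by (auto simp: A_def B_def C_def)
  moreover have "lengthen_last ` A \<inter> (?b ` B \<union> ?c ` C) = {}" "?b ` B \<inter> ?c ` C = {}"
    by (auto simp: lengthen_last_def prod_eq_iff)
  ultimately have "card (slack_words f (Suc l) j n) =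
      card (lengthen_last ` A) + (card (?b ` B) + card (?c ` C))"
    by (simp add: card_Un_disjoint)
  also have "card (lengthen_last ` A) = card A"
    using inj_on_lengthen_last by (intro card_image) (auto simp: A_def)
  also have "card (?b ` B) = card B" by (intro card_image inj_onI) simp
  also have "card (?c ` C) = card C" by (intro card_image inj_onI) simp
  finally show ?thesis by (simp add: A_def B_def C_def)
qed


section \<open>The trace and the area of a path\<close>

lemma closed_segment_horizontal:
  "closed_segment (a, y) (b, y) = closed_segment a b \<times> {y :: real}" for a b :: real
proof -
  have "(1 - u) * y + u * y = y" for u by (simp add: algebra_simps)
  then show ?thesis by (auto simp: closed_segment_def)
qed

lemma closed_segment_rise:
  "closed_segment (a, y) (a + d, y + 1) =
     {(u, v). y \<le> v \<and> v \<le> y + 1 \<and> u = a + d * (v - y)}" for a d y :: real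
proof (intro set_eqI iffI)
  fix z assume "z \<in> closed_segment (a, y) (a + d, y + 1)"
  then obtain t where "0 \<le> t" "t \<le> 1" "z = (1 - t) *\<^sub>R (a, y) + t *\<^sub>R (a + d, y + 1)"
    by (auto simp: closed_segment_def)
  then show "z \<in> {(u, v). y \<le> v \<and> v \<le> y + 1 \<and> u = a + d * (v - y)}"
    by (auto simp: algebra_simps)
next
  fix z assume "z \<in> {(u, v). y \<le> v \<and> v \<le> y + 1 \<and> u = a + d * (v - y)}"
  then obtain v where v: "y \<le> v" "v \<le> y + 1" "z = (a + d * (v - y), v)" by auto
  then have "z = (1 - (v - y)) *\<^sub>R (a, y) + (v - y) *\<^sub>R (a + d, y + 1)"
    by (simp add: algebra_simps)
  then show "z \<in> closed_segment (a, y) (a + d, y + 1)"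
    using v(1,2) unfolding closed_segment_def by (intro CollectI exI[of _ "v - y"]) auto
qed

lemma real_pt_add: "real_pt (v + w) = real_pt v + real_pt w"
  by (simp add: real_pt_def)

lemma path_trace_snoc:
  "path_trace (p @ [t]) = path_trace p \<union>
     closed_segment (real_pt (vertex p (length p))) (real_pt (vertex p (length p) + step_vec t))"
proof -
  have "vertex (p @ [t]) (Suc (length p)) = vertex p (length p) + step_vec t"
    by (simp add: vertex_def)
  then show ?thesis
    by (auto simp: path_trace_def lessThan_Suc vertex_append less_Suc_eq)
qed

lemma endpoint_in_path_trace: "real_pt (vertex p (length p)) \<in> path_trace p"
proof (cases p rule: rev_cases)
  case Nil
  then show ?thesis by (simp add: path_trace_def)
next
  case (snoc q t)
  have "vertex p (length p) = vertex q (length q) + step_vec t"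
    by (simp add: snoc vertex_def)
  then show ?thesis by (simp add: snoc path_trace_snoc)
qed

lemma path_trace_lefts:
  assumes "real_pt (vertex p (length p)) = (x, y)"
  shows "path_trace (p @ replicate k L) = path_trace p \<union> {x - k..x} \<times> {y}"
proof (induction k)
  case 0
  then show ?case using endpoint_in_path_trace[of p] assms by auto
next
  case (Suc k)
  have "real_pt (vertex (p @ replicate k L) (length (p @ replicate k L))) = (x - k, y)"
    using assms unfolding vertex_full
    by (simp add: real_pt_def sum_list_replicate_pair prod_eq_iff)
  then have "path_trace ((p @ replicate k L) @ [L]) =
      path_trace (p @ replicate k L) \<union> closed_segment (x - k, y) (x - k - 1, y)"
    unfolding path_trace_snoc real_pt_add by (simp add: real_pt_def)
  also have "closed_segment (x - k, y) (x - k - 1, y) = {x - k - 1..x - k} \<times> {y}"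
    by (simp add: closed_segment_horizontal closed_segment_eq_real_ivl)
  also have "path_trace (p @ replicate k L) \<union> {x - k - 1..x - k} \<times> {y} =
      path_trace p \<union> {x - Suc k..x} \<times> {y}"
    unfolding Suc by (auto simp: algebra_simps)
  finally show ?case by (simp add: replicate_append_same)
qed

lemma path_trace_rights: "path_trace (replicate m R) = {0..real m} \<times> {0}"
proof (induction m)
  case 0
  show ?case by (auto simp: path_trace_def real_pt_def vertex_def)
next
  case (Suc m)
  have "real_pt (vertex (replicate m R) (length (replicate m R))) = (real m, 0)"
    unfolding vertex_full by (simp add: real_pt_def sum_list_replicate_pair)
  then have "path_trace (replicate m R @ [R]) =
      path_trace (replicate m R) \<union> closed_segment (real m, 0) (real m + 1, 0)"
    unfolding path_trace_snoc real_pt_add by (simp add: real_pt_def)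
  also have "closed_segment (real m, 0) (real m + 1, 0) = {real m..real m + 1} \<times> {0 :: real}"
    by (simp add: closed_segment_horizontal closed_segment_eq_real_ivl)
  also have "path_trace (replicate m R) \<union> {real m..real m + 1} \<times> {0} = {0..real (Suc m)} \<times> {0}"
    unfolding Suc by auto
  finally show ?case by (simp add: replicate_append_same)
qed

text \<open>The abscissa at which the path leaves row \<open>r\<close> (or ends, for the last row).\<close>

definition departure :: "nat \<Rightarrow> (bool \<times> nat) list \<Rightarrow> nat \<Rightarrow> real" where
  "departure m bs r = real m + (\<Sum>i<r. of_bool (fst (bs ! i)) - real (snd (bs ! i)))"

definition slant :: "(bool \<times> nat) list \<Rightarrow> nat \<Rightarrow> real" where
  "slant bs r = of_bool (fst (bs ! r))"

lemma departure_Suc: "departure m bs (Suc r) = departure m bs r + slant bs r - real (snd (bs ! r))"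
  by (simp add: departure_def slant_def)

lemma staircase_cong:
  assumes "\<And>r. r \<le> n \<Longrightarrow> c r = c' r" "\<And>r. r < n \<Longrightarrow> d r = d' r"
  shows "staircase n c d = staircase n c' d'"
  unfolding staircase_def using assms by (intro arg_cong2[of _ _ _ _ "(\<union>)"] SUP_cong) auto

lemma endpoint_row_path_departure:
  "real_pt (vertex (row_path m bs) (length (row_path m bs))) =
     (departure m bs (length bs), real (length bs))"
proof -
  have "real_of_int (\<Sum>(d, k)\<leftarrow>bs. of_bool d - int k) =
      (\<Sum>i<length bs. of_bool (fst (bs ! i)) - real (snd (bs ! i)))"
    by (induction bs rule: rev_induct) (auto simp: nth_append)
  then show ?thesis unfolding endpoint_row_path by (simp add: real_pt_def departure_def)
qed

text \<open>Adding a row to the path appends one slanted segment and one horizontal one; the abscissae of the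
  lower rows depend only on what comes before.\<close>

lemma path_trace_row_path:
  "path_trace (row_path m bs) = staircase (length bs) (departure m bs) (slant bs)"
proof (induction bs rule: rev_induct)
  case Nil
  show ?case by (simp add: row_path_def path_trace_rights staircase_def departure_def)
next
  case (snoc b bs)
  obtain d k where b: "b = (d, k)" by (cases b)
  let ?n = "length bs" and ?bs = "bs @ [b]"
  let ?x = "departure m bs (length bs)" and ?d = "of_bool d :: real"
  have departure: "departure m ?bs r = departure m bs r" if "r \<le> ?n" for r
    using that by (simp add: departure_def nth_append)
  have slant: "slant ?bs r = slant bs r" if "r < ?n" for r
    using that by (simp add: slant_def nth_append)
  have top: "slant ?bs ?n = ?d" "departure m ?bs (Suc ?n) = ?x + ?d - real k"
    by (simp_all add: departure_Suc departure) (simp_all add: slant_def b)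
  have end1: "real_pt (vertex (row_path m bs @ [rise d]) (length (row_path m bs @ [rise d]))) =
      (?x + ?d, real ?n + 1)"
    using endpoint_row_path_departure[of m bs] unfolding vertex_full
    by (auto simp: real_pt_def rise_def)
  have "path_trace (row_path m ?bs) =
      path_trace (row_path m bs @ [rise d]) \<union> {?x + ?d - k..?x + ?d} \<times> {real ?n + 1}"
    unfolding b row_path_snoc by (rule path_trace_lefts[OF end1])
  also have "path_trace (row_path m bs @ [rise d]) =
      path_trace (row_path m bs) \<union> closed_segment (?x, real ?n) (?x + ?d, real ?n + 1)"
    unfolding path_trace_snoc real_pt_add endpoint_row_path_departure
    by (simp add: real_pt_def rise_def)
  also have "path_trace (row_path m bs) = staircase ?n (departure m ?bs) (slant ?bs)"
    unfolding snoc.IH using departure slant by (intro staircase_cong) auto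
  finally show ?case
    unfolding length_append_singleton staircase_Suc top departure[OF order_refl] closed_segment_rise .
qed

text \<open>The number of right steps that makes the path end on the line.\<close>

definition start :: "nat \<Rightarrow> (bool \<times> nat) list \<Rightarrow> nat" where
  "start f bs = (\<Sum>(d, k)\<leftarrow>bs. k + (f - of_bool d))"

lemma start_closes:
  assumes "f \<ge> 1"
  shows "int m + (\<Sum>(d, k)\<leftarrow>bs. of_bool d - int k) = int f * int (length bs) \<longleftrightarrow> m = start f bs"
proof -
  have "int (start f bs) + (\<Sum>(d, k)\<leftarrow>bs. of_bool d - int k) = int f * int (length bs)"
    using assms by (induction bs) (auto simp: start_def of_nat_diff algebra_simps)
  then show ?thesis by linarith
qed

text \<open>Going down one row from the endpoint, the line moves \<open>f\<close> units to the left and the point of departure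
  at most one, so the path stays right of the line.\<close>

lemma closed_staircase_row_path:
  assumes f: "f \<ge> 1"
  shows "closed_staircase (real f) (length bs) (departure (start f bs) bs) (slant bs)"
proof
  let ?c = "departure (start f bs) bs" and ?l = "length bs"
  show final: "?c ?l = real f * real ?l"
  proof -
    have "real_pt (int f * int ?l, int ?l) = (?c ?l, real ?l)"
      using endpoint_row_path_departure[of "start f bs" bs] start_closes[OF f, of "start f bs" bs]
      unfolding endpoint_row_path by simp
    then show ?thesis by (simp add: real_pt_def)
  qed
  show "real f * real r \<le> ?c r" if "r \<le> ?l" for r
    using that
  proof (induction rule: inc_induct)
    case (step r)
    have "?c (Suc r) \<le> ?c r + 1" by (simp add: departure_Suc slant_def)
    moreover have "real f * real (Suc r) = real f * real r + real f" by (simp add: algebra_simps)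
    ultimately show ?case using step.IH f by linarith
  qed (simp add: final)
qed (use f in \<open>simp_all add: departure_Suc\<close>)

text \<open>Each strip contributes the sum of its two boundary widths. Summing this by rows amounts to a
  summation by parts, whose boundary term vanishes because the path ends on the line.\<close>

lemma enclosed_area_row_path:
  assumes f: "f \<ge> 1"
  shows "enclosed_area f (row_path (start f bs) bs) = real (twice_area f bs) / 2"
proof -
  let ?c = "departure (start f bs) bs" and ?l = "length bs"
  interpret closed_staircase "real f" ?l ?c "slant bs"
    by (rule closed_staircase_row_path[OF f])
  have diff: "real (f - of_bool b) = real f - of_bool b" for b
    using f by (simp add: of_nat_diff)
  \<comment> \<open>The formula for a truncated path, with the boundary term at height n still present.\<close>
  have "(\<Sum>r<n. (?c r - real f * r) + (?c r + slant bs r - real f * (real r + 1))) =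
      2 * real n * (?c n - real f * n) +
      (\<Sum>i<n. 2 * (real i + 1) * snd (bs ! i) + (2 * real i + 1) * (real f - slant bs i))" for n
    by (induction n) (simp_all add: departure_Suc algebra_simps)
  from this[of ?l] have "(\<Sum>r<?l. (?c r - real f * r) + (?c r + slant bs r - real f * (real r + 1))) =
      (\<Sum>i<?l. 2 * (real i + 1) * snd (bs ! i) + (2 * real i + 1) * (real f - slant bs i))"
    using final by simp
  also have "\<dots> = real (twice_area f bs)"
    unfolding twice_area_def of_nat_sum of_nat_add of_nat_mult diff slant_def by simp
  finally have "(\<Sum>r<?l. (?c r - real f * r) + (?c r + slant bs r - real f * (real r + 1))) =
      real (twice_area f bs)" .
  moreover have "enclosed_area f (row_path (start f bs) bs) = measure lborel (inside barrier)"
    by (simp add: enclosed_area_def barrier_def path_trace_row_path slope_line_def)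
  ultimately show ?thesis
    unfolding area_staircase sum_divide_distrib[symmetric] by simp
qed

lemma row_path_below_line:
  assumes f: "f \<ge> 1"
  shows "\<forall>(x, y)\<in>path_trace (row_path (start f bs) bs). y \<le> x / real f"
proof -
  interpret closed_staircase "real f" "length bs" "departure (start f bs) bs" "slant bs"
    by (rule closed_staircase_row_path[OF f])
  show ?thesis
    unfolding path_trace_row_path using staircase_right_of_line f
    by (fastforce simp: field_simps)
qed

section \<open>Paths as slack words\<close>

definition slack_path :: "nat \<Rightarrow> (bool \<times> nat) list \<Rightarrow> step list" where
  "slack_path f w = row_path (start f (pad w)) (pad w)"

lemma schroeder_backwards_eq_image:
  assumes f: "f \<ge> 1"
  shows "schroeder_backwards f i j l =
     slack_path f ` {w. length w = l \<and> twice_area f (pad w) = j \<and> 2 * length (filter fst w) = i}"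
    (is "?S = slack_path f ` ?W")
proof (intro set_eqI iffI)
  fix p assume p: "p \<in> ?S"
  then have row: "row_condition l p" and final: "vertex p (length p) = (int f * int l, int l)"
    by (auto simp: schroeder_backwards_def)
  obtain m w where w: "length w = l" and pw: "p = row_path m (pad w)"
    using row final row_condition_imp_row_path[of l p] by auto
  have "m = start f (pad w)"
    using final w start_closes[OF f, of m "pad w"]
    unfolding pw endpoint_row_path by simp
  then have path: "p = slack_path f w" by (simp add: slack_path_def pw)
  have "real (twice_area f (pad w)) / 2 = real j / 2"
    using p enclosed_area_row_path[OF f, of "pad w"]
    by (simp add: schroeder_backwards_def path slack_path_def)
  moreover have "real (length (filter fst w)) = real i / 2"
    using p by (simp add: schroeder_backwards_def pw count_diagonals_row_path)
  ultimately have "w \<in> ?W" using w by simp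
  then show "p \<in> slack_path f ` ?W" using path by blast
next
  fix p assume "p \<in> slack_path f ` ?W"
  then obtain w where w: "length w = l" "twice_area f (pad w) = j" "2 * length (filter fst w) = i"
    and p: "p = row_path (start f (pad w)) (pad w)"
    by (auto simp: slack_path_def)
  have "vertex p (length p) = (int f * int l, int l)"
    unfolding p endpoint_row_path using start_closes[OF f, of "start f (pad w)" "pad w"] w(1) by simp
  moreover have "row_condition l p"
    using row_condition_row_path_pad[of w] w(1)
    by (cases "w = []") (auto simp: p row_condition_def row_path_def start_def)
  moreover have "enclosed_area f p = real j / 2"
    using enclosed_area_row_path[OF f, of "pad w"] by (simp add: p w(2))
  moreover have "real (count_list p D) = real i / 2"
    using w(3) by (auto simp: p count_diagonals_row_path)
  ultimately show "p \<in> ?S"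
    using row_path_below_line[OF f, of "pad w"] no_backtrack_row_path
    unfolding schroeder_backwards_def p by blast
qed

lemma u_count_eq_card_slack_words:
  assumes f: "f \<ge> 1"
  shows "u_count f i j l = (if even i then card (slack_words f l j (i div 2)) else 0)"
proof -
  have "inj_on (slack_path f) W" for W
    unfolding slack_path_def by (intro inj_onI) (metis row_path_inject pad_inject)
  then have "u_count f i j l = card {w. length w = l \<and> twice_area f (pad w) = j \<and>
      2 * length (filter fst w) = i}"
    unfolding u_count_def schroeder_backwards_eq_image[OF f] by (rule card_image)
  also have "{w. length w = l \<and> twice_area f (pad w) = j \<and> 2 * length (filter fst w) = i} =
      (if even i then slack_words f l j (i div 2) else {})"
    by (auto simp: slack_words_def)
  finally show ?thesis by simp
qed

section \<open>The functional equation\<close>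

lemma q_dilate_nth: "fps_nth (q_dilate k F) l = fps_X ^ (k * l) * fps_nth F l"
proof -
  have "q_dilate k F = fps_compose F (fps_const (fps_X ^ k) * fps_X)"
    by (simp add: q_dilate_def vq_def vx_def)
  then show ?thesis by (simp add: fps_compose_linear power_mult)
qed

text \<open>Comparing coefficients turns the functional equation into a recurrence in the degree in \<open>x\<close>. It
  leaves the constant coefficient free, hence the initial value.\<close>

lemma functional_equation_iff:
  fixes F :: qxseries
  shows "F = q_dilate 2 F
            + vq ^ f * vx * q_dilate (2 * (f + 1)) F
            + va ^ 2 * vq ^ (f - 1) * vx * q_dilate (2 * f) F \<longleftrightarrow>
         (\<forall>l. fps_nth F (Suc l) = fps_X ^ (2 * Suc l) * fps_nth F (Suc l)
            + fps_X ^ (f + 2 * (f + 1) * l) * fps_nth F l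
            + fps_const (monom 1 2) * (fps_X ^ (f - 1 + 2 * f * l) * fps_nth F l))"
    (is "F = ?G \<longleftrightarrow> (\<forall>l. _ = ?h l)")
proof -
  have a2: "va ^ 2 = fps_const (fps_const (monom 1 2))"
    by (simp add: va_def monom_altdef)
  have up: "vq ^ f * vx * G = fps_const (fps_X ^ f) * (fps_X * G)" for G
    by (simp add: vq_def vx_def mult.assoc)
  have diag: "va ^ 2 * vq ^ (f - 1) * vx * G =
      fps_const (fps_const (monom 1 2) * fps_X ^ (f - 1)) * (fps_X * G)" for G
    by (simp add: a2 vq_def vx_def mult.assoc)
  have "fps_nth ?G 0 = fps_nth F 0"
    unfolding up diag by (simp add: q_dilate_nth)
  moreover have "fps_nth ?G (Suc l) = ?h l" for l
    unfolding up diag by (simp add: q_dilate_nth power_add mult.assoc del: mult_Suc_right)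
  ultimately have "F = ?G \<longleftrightarrow> (\<forall>l. fps_nth F (Suc l) = ?h l)"
    unfolding fps_eq_iff by (metis not0_implies_Suc)
  then show ?thesis .
qed

text \<open>The difference \<open>H\<close> of two solutions' coefficients satisfies \<open>(1 - q\<^sup>m) H = 0\<close> with \<open>m > 0\<close> as soon as
  the preceding coefficients agree, and the coefficient ring is a domain.\<close>

lemma functional_equation_unique:
  fixes F G :: qxseries
  assumes F: "F = q_dilate 2 F + vq ^ f * vx * q_dilate (2 * (f + 1)) F
                + va ^ 2 * vq ^ (f - 1) * vx * q_dilate (2 * f) F"
    and G: "G = q_dilate 2 G + vq ^ f * vx * q_dilate (2 * (f + 1)) G
                + va ^ 2 * vq ^ (f - 1) * vx * q_dilate (2 * f) G"
    and init: "fps_nth F 0 = fps_nth G 0"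
  shows "F = G"
proof -
  have "fps_nth F l = fps_nth G l" for l
  proof (induction l)
    case (Suc l)
    let ?X = "fps_X ^ (2 * Suc l) :: int poly fps"
    define H where "H = fps_nth F (Suc l) - fps_nth G (Suc l)"
    have "H = ?X * H"
      unfolding H_def right_diff_distrib
      using arg_cong2[OF F[unfolded functional_equation_iff, rule_format, of l]
          G[unfolded functional_equation_iff, rule_format, of l], of "(-)"]
      unfolding Suc by (simp only: add_diff_cancel_right add.assoc)
    then have "(1 - ?X) * H = 0" by (simp add: algebra_simps)
    moreover have "fps_nth (1 - ?X) 0 = 1" by simp
    then have "1 - ?X \<noteq> 0" by (metis fps_zero_nth zero_neq_one)
    ultimately show ?case by (simp add: H_def)
  qed (use init in simp)
  then show ?thesis by (simp add: fps_eq_iff)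
qed

lemma schroeder_gf_satisfies_functional_equation:
  assumes "f \<ge> 1"
  defines "F \<equiv> schroeder_gf f"
  shows "F = q_dilate 2 F + vq ^ f * vx * q_dilate (2 * (f + 1)) F
             + va ^ 2 * vq ^ (f - 1) * vx * q_dilate (2 * f) F"
  unfolding functional_equation_iff
proof (intro allI fps_ext poly_eqI)
  fix l j i
  have coeff: "coeff (fps_nth (fps_nth F l) j) i =
     (if even i then int (card (slack_words f l j (i div 2))) else 0)" for l j i
    by (simp add: F_def coeff_schroeder_gf u_count_eq_card_slack_words[OF assms(1)])
  have shift: "coeff (monom 1 2 * p) i = (if i < 2 then 0 else coeff p (i - 2))" for p :: "int poly" and i
    by (simp add: coeff_monom_mult)
  have i2: "(i - 2) div 2 = i div 2 - Suc 0" "even i \<Longrightarrow> (1 \<le> i div 2) = (2 \<le> i)" by auto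
  show "coeff (fps_nth (fps_nth F (Suc l)) j) i =
     coeff (fps_nth (fps_X ^ (2 * Suc l) * fps_nth F (Suc l)
            + fps_X ^ (f + 2 * (f + 1) * l) * fps_nth F l
            + fps_const (monom 1 2) * (fps_X ^ (f - 1 + 2 * f * l) * fps_nth F l)) j) i"
    unfolding fps_add_nth fps_mult_left_const_nth fps_X_power_mult_nth coeff_add shift
    using card_slack_words_Suc[OF assms(1), of l j "i div 2"]
    by (cases "even i") (auto simp: coeff i2 shift simp del: mult_Suc_right)
qed

theorem proposition2p5:
  fixes f :: nat
  assumes "f \<ge> 1"
  shows "schroeder_gf f =
           q_dilate 2 (schroeder_gf f)
           + vq ^ f * vx * q_dilate (2 * (f + 1)) (schroeder_gf f)
           + va ^ 2 * vq ^ (f - 1) * vx * q_dilate (2 * f) (schroeder_gf f)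
         \<and> fps_nth (schroeder_gf f) 0 = 1
         \<and> (\<forall>F :: qxseries.
              F = q_dilate 2 F
                  + vq ^ f * vx * q_dilate (2 * (f + 1)) F
                  + va ^ 2 * vq ^ (f - 1) * vx * q_dilate (2 * f) F
              \<and> fps_nth F 0 = 1
              \<longrightarrow> F = schroeder_gf f)"
proof (intro conjI allI impI)
  note count = u_count_eq_card_slack_words[OF assms]
  show eq: "schroeder_gf f =
           q_dilate 2 (schroeder_gf f)
           + vq ^ f * vx * q_dilate (2 * (f + 1)) (schroeder_gf f)
           + va ^ 2 * vq ^ (f - 1) * vx * q_dilate (2 * f) (schroeder_gf f)"
    by (rule schroeder_gf_satisfies_functional_equation[OF assms])
  show init: "fps_nth (schroeder_gf f) 0 = 1"
  proof (intro fps_ext poly_eqI)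
    fix j i
    have "slack_words f 0 j n = (if j = 0 \<and> n = 0 then {[]} else {})" for j n
      by (auto simp: slack_words_def)
    then show "coeff (fps_nth (fps_nth (schroeder_gf f) 0) j) i = coeff (fps_nth 1 j) i"
      by (auto simp: coeff_schroeder_gf count coeff_1 elim: evenE intro: odd_pos)
  qed
  fix F :: qxseries
  assume "F = q_dilate 2 F
                  + vq ^ f * vx * q_dilate (2 * (f + 1)) F
                  + va ^ 2 * vq ^ (f - 1) * vx * q_dilate (2 * f) F
              \<and> fps_nth F 0 = 1"
  then show "F = schroeder_gf f"
    using functional_equation_unique[OF _ eq] init by metis
qed

end
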